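(* With multiplication of decimals defined by formal limits, $c\cdot d=\mathrm{flim}_n\,(c|n\cdot d|n)$, the equation $x^2=2$ has no solution in the set of decimals $\mathbb{D}$, and the equation $x^2=1.999\dots$ has no solution in the subset $\mathbb{P}\subset\mathbb{D}$ of ultimately periodic decimals.
   Context: Here $\mathbb{N}=\{1,2,\dots\}$. Decimals. A signed decimal $d$ is a pair of a sign $+$ or $-$ and an infinite string of digits $d=\pm a_ka_{k-1}a_{k-2}\dots$ indexed by the integers $k,k-1,k-2,\dots$, where $k\in\mathbb{Z}$, $a_i\in\{0,1,\dots,9\}\subset\mathbb{Z}$ and $a_k\neq 0$. The zero decimal $0$ has no sign and only zero digits. $\mathbb{D}$ is the set of all decimals (signed and zero). $d_i$ denotes the $i$th digit $a_i$ of $d$, with $d_i=0$ if $a_i$ does not exist. Two decimals are equal iff they have equal signs and $d_i=e_i$ for all $i\in\mathbb{Z}$, or both are zero (so $1.999\dots$, with all digits after the decimal point equal to $9$, and $2=2.000\dots$ are different decimals). The usual decimal point notation is used ($+$ sign and trailing zeros omitted). Ultimately periodic decimals. $\mathbb{P}$ is the set of $d\in\mathbb{D}$ for which there are $m\in\mathbb{Z}$ and $p\in\mathbb{N}$ such that $d_i=d_{i-p}$ for every $i<m$. Terminating decimals. $\mathbb{T}_0$ is the set of decimals with only finitely many nonzero digits (including $0$), and $\mathbb{Z}_0$ is the set of decimals $d$ with $d_i=0$ for all $i<0$. Decadic notation $0\mapsto 0$, $\pm a_k\dots a_0000\dots\mapsto\pm(a_k10^k+\dots+a_010^0)$ is a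 bijection $\mathbb{Z}_0\to\mathbb{Z}$, and multiplication on $\mathbb{Z}_0$ is transferred from $\mathbb{Z}$ by it. For $d\in\mathbb{D}$ and $k\in\mathbb{Z}$, $10^kd$ is the decimal with the same sign as $d$ and $(10^kd)_i=d_{i-k}$. For $c,d\in\mathbb{T}_0$ define $c\cdot d=10^{-2k}(10^kc\cdot 10^kd)$, where $k$ is any integer with $10^kc,10^kd\in\mathbb{Z}_0$ (the result does not depend on $k$). Formal limits. For $n\in\mathbb{N}$ and $d\in\mathbb{D}$ the truncation $d|n\in\mathbb{T}_0$ has the same sign as $d$ and $(d|n)_i=d_i$ for $i\ge -n$, $(d|n)_i=0$ for $i<-n$; if all its digits are zero, $d|n$ is the zero decimal. A decimal $c$ is the formal limit of a sequence of terminating decimals $c(n)$, $n=1,2,\dots$, written $\mathrm{flim}_n\,c(n)=c$, if for every $k\in\mathbb{N}$ there is $N\in\mathbb{N}$ such that for every $n>N$ the decimals $c$ and $c(n)$ have the same sign or $c$ is zero, and $c(n)|k=c|k$. A formal limit is unique if it exists. Multiplication on $\mathbb{D}$. For $c,d\in\mathbb{D}$, $c\cdot d=\mathrm{flim}_n\,(c|n\cdot d|n)$ (this limit always exists), and $x^2=x\cdot x$. *)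

theory Defs
  imports "HOL-Analysis.Analysis"
begin

text \<open>A decimal is a sign together with its digits, indexed by all integers and padded with
  zeros to the left of the leading digit. The sign is \<open>1\<close> or \<open>-1\<close>; the value \<open>0\<close> encodes
  ``no sign'' and occurs exactly for the zero decimal. No digit strings are identified, so
  equality in this type is equality of signs and of all digits.\<close>

definition decimal_reps :: "(int \<times> (int \<Rightarrow> int)) set" where
  "decimal_reps = {(s :: int, a :: int \<Rightarrow> int).
      (s = 0 \<and> (\<forall>i. a i = 0)) \<or>
      (s \<in> {1, -1} \<and> (\<forall>i. a i \<in> {0..9}) \<and> (\<exists>k. a k \<noteq> 0 \<and> (\<forall>i>k. a i = 0)))}"

typedef decimal = decimal_reps
  morphisms rep_decimal abs_decimal
  by (rule exI[of _ "(0, \<lambda>_. 0)"]) (simp add: decimal_reps_def)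

setup_lifting type_definition_decimal

lift_definition dsign :: "decimal \<Rightarrow> int" is fst .

lift_definition digit :: "decimal \<Rightarrow> int \<Rightarrow> int" is snd .

lemma decimal_eqI:
  assumes "dsign c = dsign d" "\<And>i. digit c i = digit d i"
  shows "c = d"
  using assms by transfer (auto simp: prod_eq_iff fun_eq_iff)

lemma decimal_cases:
  "(dsign d = 0 \<and> (\<forall>i. digit d i = 0)) \<or>
   (dsign d \<in> {1, -1} \<and> (\<forall>i. digit d i \<in> {0..9}) \<and>
     (\<exists>k. digit d k \<noteq> 0 \<and> (\<forall>i>k. digit d i = 0)))"
  by transfer (auto simp: decimal_reps_def)

instantiation decimal :: zero
begin
lift_definition zero_decimal :: decimal is "(0, \<lambda>_. 0)" by (simp add: decimal_reps_def)
instance ..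
end

text \<open>\<open>shift k d\<close> is $10^k d$.\<close>

lift_definition shift :: "int \<Rightarrow> decimal \<Rightarrow> decimal" is "\<lambda>k (s, a). (s, \<lambda>i. a (i - k))"
proof -
  fix k :: int and x :: "int \<times> (int \<Rightarrow> int)"
  obtain s a where x: "x = (s, a)" by (cases x)
  assume "x \<in> decimal_reps"
  then consider "s = 0" "\<forall>i. a i = 0"
    | l where "s \<in> {1, -1}" "\<forall>i. a i \<in> {0..9}" "a l \<noteq> 0" "\<forall>i>l. a i = 0"
    unfolding x decimal_reps_def by auto
  then show "(case x of (s, a) \<Rightarrow> (s, \<lambda>i. a (i - k))) \<in> decimal_reps"
  proof cases
    case 1
    then show ?thesis by (simp add: x decimal_reps_def)
  next
    case 2
    have "\<exists>m. a (m - k) \<noteq> 0 \<and> (\<forall>i>m. a (i - k) = 0)"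
      using 2 by (intro exI[of _ "l + k"]) auto
    with 2(1,2) show ?thesis unfolding x decimal_reps_def by simp
  qed
qed

definition T0 :: "decimal set" where
  "T0 = {d. finite {i. digit d i \<noteq> 0}}"

definition Z0 :: "decimal set" where
  "Z0 = {d. \<forall>i<0. digit d i = 0}"

definition ult_periodic :: "decimal set" where
  "ult_periodic = {d. \<exists>m::int. \<exists>p::nat. p \<ge> 1 \<and> (\<forall>i<m. digit d i = digit d (i - int p))}"

text \<open>Decadic notation, to be used on \<^const>\<open>Z0\<close>. The sum ranges over a finite set because
  the digits of a decimal vanish from some index upwards.\<close>

definition decadic :: "decimal \<Rightarrow> int" where
  "decadic d = dsign d * (\<Sum>i | i \<ge> 0 \<and> digit d i \<noteq> 0. digit d i * 10 ^ nat i)"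

definition Z0_mult :: "decimal \<Rightarrow> decimal \<Rightarrow> decimal" where
  "Z0_mult c d = inv_into Z0 decadic (decadic c * decadic d)"

text \<open>The product of terminating decimals; any admissible \<open>k\<close> gives the same result.\<close>

definition T0_mult :: "decimal \<Rightarrow> decimal \<Rightarrow> decimal" where
  "T0_mult c d =
     (let k = (SOME k. shift k c \<in> Z0 \<and> shift k d \<in> Z0)
      in shift (- 2 * k) (Z0_mult (shift k c) (shift k d)))"

lift_definition trunc :: "decimal \<Rightarrow> nat \<Rightarrow> decimal" is
  "\<lambda>d n. if \<forall>i \<ge> - int n. snd d i = 0 then (0, \<lambda>_. 0)
          else (fst d, \<lambda>i. if i \<ge> - int n then snd d i else 0)"
proof -
  fix x :: "int \<times> (int \<Rightarrow> int)" and n :: nat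
  obtain s a where x: "x = (s, a)" by (cases x)
  assume "x \<in> decimal_reps"
  then consider "\<forall>i. a i = 0"
    | l where "s \<in> {1, -1}" "\<forall>i. a i \<in> {0..9}" "a l \<noteq> 0" "\<forall>i>l. a i = 0"
    unfolding x decimal_reps_def by auto
  then show "(if \<forall>i \<ge> - int n. snd x i = 0 then (0, \<lambda>_. 0)
          else (fst x, \<lambda>i. if i \<ge> - int n then snd x i else 0)) \<in> decimal_reps"
  proof cases
    case 1
    then show ?thesis by (simp add: x decimal_reps_def)
  next
    case 2
    show ?thesis
    proof (cases "\<forall>i \<ge> - int n. a i = 0")
      case True
      then show ?thesis by (simp add: x decimal_reps_def)
    next
      case False
      then obtain i where i: "i \<ge> - int n" "a i \<noteq> 0" by auto
      with 2 have "i \<le> l" by (meson not_less)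
      with i have "l \<ge> - int n" by simp
      with 2 False show ?thesis unfolding x decimal_reps_def by auto
    qed
  qed
qed

definition is_flim :: "(nat \<Rightarrow> decimal) \<Rightarrow> decimal \<Rightarrow> bool" where
  "is_flim f c \<longleftrightarrow>
     (\<forall>n\<ge>1. f n \<in> T0) \<and>
     (\<forall>k\<ge>1. \<exists>N\<ge>1. \<forall>n>N. (dsign c = dsign (f n) \<or> c = 0) \<and> trunc (f n) k = trunc c k)"

definition flim :: "(nat \<Rightarrow> decimal) \<Rightarrow> decimal" where
  "flim f = (THE c. is_flim f c)"

instantiation decimal :: times
begin
definition times_decimal :: "decimal \<Rightarrow> decimal \<Rightarrow> decimal" where
  "c * d = flim (\<lambda>n. T0_mult (trunc c n) (trunc d n))"
instance ..
end

text \<open>The decimals $2 = 2.000\dots$ and $1.999\dots$\<close>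

lift_definition dec_two :: decimal is "(1, \<lambda>i. if i = 0 then 2 else 0)"
  by (auto simp: decimal_reps_def intro: exI[of _ 0])

lift_definition dec_one_nines :: decimal is
  "(1, \<lambda>i. if i > 0 then 0 else if i = 0 then 1 else 9)"
  by (auto simp: decimal_reps_def intro!: exI[of _ 0])


subsection \<open>Well-definedness of decadic notation and of formal limits\<close>

lemma digit_shift [simp]: "digit (shift k d) i = digit d (i - k)"
  by transfer auto

lemma dsign_shift [simp]: "dsign (shift k d) = dsign d"
  by transfer auto

lemma digit_trunc: "digit (trunc d n) i = (if i \<ge> - int n then digit d i else 0)"
  by transfer auto

lemma dsign_trunc:
  "dsign (trunc d n) = (if \<forall>i \<ge> - int n. digit d i = 0 then 0 else dsign d)"
  by transfer auto

lemma digit_range: "0 \<le> digit d i" "digit d i \<le> 9"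
  using decimal_cases[of d] by auto

lemma digit_bounded: "\<exists>K::nat. \<forall>i \<ge> int K. digit d i = 0"
proof -
  obtain k where "\<forall>i>k. digit d i = 0" using decimal_cases[of d] by auto
  then show ?thesis by (intro exI[of _ "nat (k + 1)"]) auto
qed

lemma dsign_eq_0_iff: "dsign d = 0 \<longleftrightarrow> (\<forall>i. digit d i = 0)"
  using decimal_cases[of d] by auto

lemma is_flim_unique:
  assumes "is_flim f c" "is_flim f c'"
  shows "c = c'"
proof -
  have trunc_eq: "trunc c k = trunc c' k" if k: "k \<ge> 1" for k
  proof -
    obtain N where "\<forall>n>N. trunc (f n) k = trunc c k"
      using assms(1) k unfolding is_flim_def by blast
    moreover obtain N' where "\<forall>n>N'. trunc (f n) k = trunc c' k"
      using assms(2) k unfolding is_flim_def by blast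
    ultimately show ?thesis
      by (metis less_Suc_eq_le max.cobounded1 max.cobounded2)
  qed
  have dig: "digit c i = digit c' i" for i
  proof -
    have "i \<ge> - int (nat (- i) + 1)" by linarith
    then show ?thesis
      using arg_cong[OF trunc_eq[of "nat (- i) + 1"], of "\<lambda>d. digit d i"]
      unfolding digit_trunc by simp
  qed
  show ?thesis
  proof (cases "\<forall>i. digit c i = 0")
    case True
    with dig show ?thesis by (metis decimal_eqI dsign_eq_0_iff)
  next
    case False
    then obtain i where i: "digit c i \<noteq> 0" by auto
    define k where "k = nat (- i) + 1"
    have "i \<ge> - int k" unfolding k_def by auto
    then have "dsign c = dsign (trunc c k)" "dsign c' = dsign (trunc c' k)"
      using i dig[of i] by (auto simp: dsign_trunc)
    moreover have "k \<ge> 1" by (simp add: k_def)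
    ultimately show ?thesis using trunc_eq[of k] dig by (auto intro: decimal_eqI)
  qed
qed

lemma flim_eqI: "is_flim f c \<Longrightarrow> flim f = c"
  unfolding flim_def by (blast intro: is_flim_unique)

lemma digits_of_sum:
  fixes f :: "nat \<Rightarrow> int"
  assumes "\<And>i. f i \<in> {0..9}"
  shows "j < n \<Longrightarrow> (\<Sum>i<n. f i * 10 ^ i) div 10 ^ j mod 10 = f j"
  using assms
proof (induction n arbitrary: f j)
  case 0
  then show ?case by simp
next
  case (Suc n)
  let ?S = "\<Sum>i<n. f (Suc i) * 10 ^ i"
  have eq: "(\<Sum>i<Suc n. f i * 10 ^ i) = f 0 + 10 * ?S"
    by (subst sum.lessThan_Suc_shift) (simp add: sum_distrib_left algebra_simps)
  have f0: "0 \<le> f 0" "f 0 \<le> 9" using Suc.prems(2)[of 0] by auto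
  show ?case
  proof (cases j)
    case 0
    have "(f 0 + 10 * ?S) mod 10 = f 0" using f0 by simp
    then show ?thesis unfolding eq 0 by simp
  next
    case (Suc j')
    have "(f 0 + 10 * ?S) div 10 ^ Suc j' = (f 0 + 10 * ?S) div 10 div 10 ^ j'"
      by (simp add: zdiv_zmult2_eq)
    also have "(f 0 + 10 * ?S) div 10 = ?S" using f0 by simp
    also have "?S div 10 ^ j' mod 10 = f (Suc j')"
      using Suc.IH[of j' "\<lambda>i. f (Suc i)"] Suc.prems Suc by auto
    finally show ?thesis unfolding eq Suc by simp
  qed
qed

lemma sum_of_digits:
  fixes N :: int
  shows "(\<Sum>i<n. (N div 10 ^ i mod 10) * 10 ^ i) = N mod 10 ^ n"
proof (induction n)
  case (Suc n)
  have "N mod (10 ^ n * 10) = 10 ^ n * (N div 10 ^ n mod 10) + N mod 10 ^ n"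
    by (rule zmod_zmult2_eq) auto
  with Suc show ?case by (simp add: mult.commute)
qed simp

lemma decadic_eq_sum:
  assumes "\<And>i. i \<ge> int K \<Longrightarrow> digit d i = 0"
  shows "decadic d = dsign d * (\<Sum>i<K. digit d (int i) * 10 ^ i)"
proof -
  have sub: "{i. i \<ge> 0 \<and> digit d i \<noteq> 0} \<subseteq> int ` {..<K}"
  proof
    fix i assume "i \<in> {i. i \<ge> 0 \<and> digit d i \<noteq> 0}"
    then have i: "i \<ge> 0" "digit d i \<noteq> 0" by auto
    then have "i = int (nat i)" "nat i < K" using assms[of i] by linarith+
    then show "i \<in> int ` {..<K}" by blast
  qed
  have "(\<Sum>i | i \<ge> 0 \<and> digit d i \<noteq> 0. digit d i * 10 ^ nat i)
      = (\<Sum>i\<in>int ` {..<K}. digit d i * 10 ^ nat i)"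
    by (rule sum.mono_neutral_left[OF _ sub]) auto
  also have "\<dots> = (\<Sum>i<K. digit d (int i) * 10 ^ i)"
    by (subst sum.reindex) auto
  finally show ?thesis by (simp add: decadic_def)
qed

lemma bij_betw_decadic: "bij_betw decadic Z0 UNIV"
proof (rule bij_betwI')
  fix c d assume cd: "c \<in> Z0" "d \<in> Z0"
  show "(decadic c = decadic d) = (c = d)"
  proof
    assume eq: "decadic c = decadic d"
    obtain K1 K2 where K: "\<forall>i \<ge> int K1. digit c i = 0" "\<forall>i \<ge> int K2. digit d i = 0"
      using digit_bounded by metis
    define S where "S = (\<lambda>K x. \<Sum>i<K. digit x (int i) * 10 ^ i)"
    have dec: "decadic c = dsign c * S K c" "decadic d = dsign d * S K d"
      if "K \<ge> K1" "K \<ge> K2" for K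
      unfolding S_def using K that by (auto intro!: decadic_eq_sum)
    have nonneg: "S K x \<ge> 0" for K x
      unfolding S_def by (intro sum_nonneg mult_nonneg_nonneg) (auto simp: digit_range)
    have pos: "S K x > 0" if x: "x \<in> Z0" "\<forall>i \<ge> int K. digit x i = 0" "dsign x \<noteq> 0" for K x
    proof -
      obtain i where i: "digit x i \<noteq> 0" using x(3) dsign_eq_0_iff by blast
      have "i \<ge> 0" using x(1) i by (force simp: Z0_def)
      moreover have "i < int K" using x(2) i by (meson not_less)
      ultimately have "nat i \<in> {..<K}" "digit x (int (nat i)) > 0"
        using i digit_range(1)[of x i] by auto
      then show ?thesis unfolding S_def
        by (intro sum_pos2[of _ "nat i"]) (auto simp: digit_range)
    qed
    define K where "K = max K1 K2"
    have KK: "K \<ge> K1" "K \<ge> K2" "\<forall>i \<ge> int K. digit c i = 0" "\<forall>i \<ge> int K. digit d i = 0"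
      using K by (auto simp: K_def)
    have eq': "dsign c * S K c = dsign d * S K d" using eq dec KK by simp
    have s: "dsign c \<in> {0, 1, -1}" "dsign d \<in> {0, 1, -1}"
      using decimal_cases[of c] decimal_cases[of d] by auto
    have "dsign c = dsign d"
      using eq' s pos[OF cd(1) KK(3)] pos[OF cd(2) KK(4)] by auto
    moreover have "S K c = S K d" 
    proof (cases "dsign c = 0")
      case True
      then have "digit c i = 0" "digit d i = 0" for i
        using dsign_eq_0_iff calculation by metis+
      then show ?thesis by (simp add: S_def)
    next
      case False
      with eq' calculation show ?thesis by simp
    qed
    moreover have "digit c i = digit d i" if "S K c = S K d" for i
    proof -
      consider "i < 0" | "i \<ge> int K" | "i \<ge> 0" "i < int K" by linarith
      then show ?thesis
      proof cases
        case 1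
        then show ?thesis using cd by (simp add: Z0_def)
      next
        case 2
        then show ?thesis using KK by simp
      next
        case 3
        have "S K x div 10 ^ nat i mod 10 = digit x i" for x
          using digits_of_sum[of "\<lambda>i. digit x (int i)" "nat i" K] 3
          by (simp add: S_def digit_range)
        then show ?thesis using that by metis
      qed
    qed
    ultimately show "c = d" by (auto intro: decimal_eqI)
  qed simp
next
  fix z :: int
  show "\<exists>d\<in>Z0. z = decadic d"
  proof (cases "z = 0")
    case True
    have "digit 0 i = 0" "dsign 0 = 0" for i by (transfer, simp)+
    then show ?thesis using True
      by (intro bexI[of _ 0]) (auto simp: decadic_def Z0_def)
  next
    case False
    define N where "N = \<bar>z\<bar>"
    have N: "N > 0" using False by (simp add: N_def)
    define a where "a = (\<lambda>i::int. if i < 0 then 0 else N div 10 ^ nat i mod 10)"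
    define K where "K = nat N"
    have "K < 10 ^ K" by (rule less_exp[THEN less_le_trans]) (simp add: power_mono)
    then have NK: "N < 10 ^ K"
      using N unfolding K_def by (metis of_nat_less_iff of_nat_numeral of_nat_power int_nat_eq less_imp_le)
    have a0: "a i = 0" if "i \<ge> int K" for i
    proof -
      have "(10::int) ^ K \<le> 10 ^ nat i" using that by (intro power_increasing) auto
      then have "N < 10 ^ nat i" using NK by linarith
      then have "N div 10 ^ nat i = 0" using N by (intro div_pos_pos_trivial) auto
      then show ?thesis by (simp add: a_def)
    qed
    have sumN: "(\<Sum>i<K. a (int i) * 10 ^ i) = N"
      using sum_of_digits[of N K] NK N by (simp add: a_def)
    then have "\<exists>i. a i \<noteq> 0" using N by (metis (no_types, lifting) mult_zero_left not_less_iff_gr_or_eq sum.neutral)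
    then obtain i0 where i0: "a i0 \<noteq> 0" by blast
    have i0K: "i0 \<ge> 0" "i0 < int K"
      using i0 a0[of i0] by (metis a_def not_less, meson not_less)
    define A where "A = {i. i \<ge> 0 \<and> i < int K \<and> a i \<noteq> 0}"
    have "finite A" by (rule finite_subset[of _ "{0..int K}"]) (auto simp: A_def)
    moreover have "A \<noteq> {}" using i0 i0K by (auto simp: A_def)
    ultimately have M: "Max A \<in> A" "\<And>i. i \<in> A \<Longrightarrow> i \<le> Max A" by auto
    have "a i = 0" if "i > Max A" for i
    proof (rule ccontr)
      assume nz: "a i \<noteq> 0"
      then have "i < int K" using a0[of i] by linarith
      moreover have "i \<ge> 0" using nz by (metis a_def not_less)
      ultimately have "i \<in> A" using nz by (simp add: A_def)
      with M(2)[of i] that show False by linarith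
    qed
    moreover have "a (Max A) \<noteq> 0" using M(1) by (simp add: A_def)
    moreover have "a i \<in> {0..9}" for i
    proof -
      have "M mod 10 \<in> {0..9}" for M :: int
        using pos_mod_bound[of 10 M] pos_mod_sign[of 10 M] unfolding atLeastAtMost_iff by linarith
      then show ?thesis unfolding a_def by simp
    qed
    moreover have sz: "sgn z \<in> {1, -1}" using False by (auto simp: sgn_if)
    ultimately have mem: "(sgn z, a) \<in> decimal_reps"
      unfolding decimal_reps_def by blast
    define d where "d = abs_decimal (sgn z, a)"
    have d: "dsign d = sgn z" "digit d = a"
      using abs_decimal_inverse[OF mem] by (simp_all add: d_def dsign.rep_eq digit.rep_eq)
    have "decadic d = sgn z * N"
      using decadic_eq_sum[of K d] a0 sumN by (simp add: d)
    also have "\<dots> = z" by (simp add: N_def sgn_mult_abs)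
    finally show ?thesis by (intro bexI[of _ d]) (auto simp: Z0_def d a_def)
  qed
qed simp

end

theory Submission
  imports Defs
begin

text \<open>Idea: write \<open>X n\<close> for the real number \<open>\<bar>x|n\<bar>\<close>. These are rational numbers increasing to
  \<open>\<bar>x\<bar>\<close>, and formal limits only see the integer parts of \<open>10^k (X n)^2\<close>, which are eventually
  constant in \<open>n\<close>; so the product exists. If \<open>x \<cdot> x = 2\<close>, the integer part for each \<open>k\<close> is
  eventually \<open>2 \<cdot> 10^k\<close>, so \<open>2 \<le> (X n)^2\<close> for large \<open>n\<close>, while monotonicity gives
  \<open>(X n)^2 \<le> 2\<close>: the square of a rational would be 2. If \<open>x \<cdot> x = 1.999\<dots>\<close>, then \<open>X n\<close> tends to
  \<open>sqrt 2\<close>, whereas for \<open>x\<close> of ultimate period \<open>p\<close> the difference \<open>X (n + p) - 10^(-p) X n\<close> is eventually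
  constant, which makes the limit rational.\<close>

section \<open>Real values of terminating decimals\<close>

text \<open>Meaningful on \<open>T0\<close> only: when infinitely many digits are nonzero, the sum
  over an infinite index set is 0 by convention.\<close>

definition val :: "decimal \<Rightarrow> real" where
  "val d = of_int (dsign d) * (\<Sum>i | digit d i \<noteq> 0. of_int (digit d i) * 10 powi i)"

lemma val_eq_sum:
  assumes "finite A" "{i. digit d i \<noteq> 0} \<subseteq> A"
  shows "val d = of_int (dsign d) * (\<Sum>i\<in>A. of_int (digit d i) * 10 powi i)"
proof -
  have "(\<Sum>i | digit d i \<noteq> 0. real_of_int (digit d i) * 10 powi i)
      = (\<Sum>i\<in>A. of_int (digit d i) * 10 powi i)"
    using assms by (intro sum.mono_neutral_left) auto
  then show ?thesis by (simp add: val_def)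
qed

lemma val_shift: "val (shift k d) = 10 powi k * val d"
proof -
  have "(\<Sum>i | digit d (i - k) \<noteq> 0. real_of_int (digit d (i - k)) * 10 powi i)
      = (\<Sum>i | digit d i \<noteq> 0. of_int (digit d i) * 10 powi (i + k))"
    by (rule sum.reindex_bij_witness[of _ "\<lambda>i. i + k" "\<lambda>i. i - k"]) auto
  also have "\<dots> = 10 powi k * (\<Sum>i | digit d i \<noteq> 0. of_int (digit d i) * 10 powi i)"
    by (simp add: sum_distrib_left power_int_add mult_ac)
  finally show ?thesis by (simp add: val_def)
qed

lemma val_Z0:
  assumes "d \<in> Z0"
  shows "val d = of_int (decadic d)"
proof -
  have "{i. i \<ge> 0 \<and> digit d i \<noteq> 0} = {i. digit d i \<noteq> 0}"
    using assms by (auto simp: Z0_def not_less[symmetric])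
  then show ?thesis
    using assms by (auto simp: val_def decadic_def Z0_def power_int_def not_less[symmetric] intro!: sum.cong)
qed

lemma digits_bounded_above:
  obtains K :: nat where "\<And>i. digit d i \<noteq> 0 \<Longrightarrow> i \<le> int K"
proof -
  obtain K where "\<forall>i \<ge> int K. digit d i = 0" using digit_bounded by blast
  then have "i \<le> int K" if "digit d i \<noteq> 0" for i using that by (meson nle_le)
  then show ?thesis by (rule that)
qed

lemma Z0_subset_T0: "Z0 \<subseteq> T0"
proof
  fix d assume d: "d \<in> Z0"
  obtain K where "\<And>i. digit d i \<noteq> 0 \<Longrightarrow> i \<le> int K" using digits_bounded_above by blast
  moreover have "i \<ge> 0" if "digit d i \<noteq> 0" for i using d that unfolding Z0_def by force
  ultimately have "{i. digit d i \<noteq> 0} \<subseteq> {0..int K}" by auto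
  then show "d \<in> T0" unfolding T0_def by (auto intro: finite_subset)
qed

lemma shift_T0: "d \<in> T0 \<Longrightarrow> shift k d \<in> T0"
proof -
  assume "d \<in> T0"
  then have "finite ((\<lambda>i. i + k) ` {i. digit d i \<noteq> 0})" by (simp add: T0_def)
  moreover have "{i. digit d (i - k) \<noteq> 0} \<subseteq> (\<lambda>i. i + k) ` {i. digit d i \<noteq> 0}"
    by (auto intro!: image_eqI[of _ _ "_ - k"])
  ultimately show ?thesis by (auto simp: T0_def intro: finite_subset)
qed

lemma trunc_T0: "trunc d n \<in> T0"
proof -
  obtain K where "\<And>i. digit d i \<noteq> 0 \<Longrightarrow> i \<le> int K" using digits_bounded_above by blast
  then have "{i. digit (trunc d n) i \<noteq> 0} \<subseteq> {- int n..int K}"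
    by (auto simp: digit_trunc split: if_splits)
  then show ?thesis unfolding T0_def by (auto intro: finite_subset)
qed

lemma T0_digits_bounded_below:
  assumes "d \<in> T0"
  obtains n :: nat where "\<And>i. i < - int n \<Longrightarrow> digit d i = 0"
proof -
  obtain l where l: "\<And>i. digit d i \<noteq> 0 \<Longrightarrow> l \<le> i"
    using assms bdd_below_finite[of "{i. digit d i \<noteq> 0}"] by (auto simp: T0_def bdd_below_def)
  have "digit d i = 0" if "i < - int (nat (- l))" for i
    using l[of i] that by linarith
  then show ?thesis by (rule that)
qed

lemma shift_Z0_exists:
  assumes "c \<in> T0" "d \<in> T0"
  obtains k where "shift k c \<in> Z0" "shift k d \<in> Z0"
proof -
  obtain m where m: "\<And>i. i < - int m \<Longrightarrow> digit c i = 0"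
    using T0_digits_bounded_below[OF assms(1)] by blast
  obtain n where n: "\<And>i. i < - int n \<Longrightarrow> digit d i = 0"
    using T0_digits_bounded_below[OF assms(2)] by blast
  show ?thesis
    by (rule that[of "int (max m n)"]) (auto simp: Z0_def intro: m n)
qed

text \<open>On \<open>Z0\<close> the product is integer multiplication carried over by the bijection
  \<open>decadic\<close>. Each factor is scaled by \<open>10 powi k\<close>, and the final shift by
  \<open>- 2 * k\<close> cancels both scalings.\<close>

lemma T0_mult_val:
  assumes "c \<in> T0" "d \<in> T0"
  shows "T0_mult c d \<in> T0" "val (T0_mult c d) = val c * val d"
proof -
  define k where "k = (SOME k. shift k c \<in> Z0 \<and> shift k d \<in> Z0)"
  \<comment> \<open>The choice operator is harmless: two terminating decimals always have a common
    admissible shift.\<close>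
  have k: "shift k c \<in> Z0" "shift k d \<in> Z0"
    using someI_ex[of "\<lambda>k. shift k c \<in> Z0 \<and> shift k d \<in> Z0"] shift_Z0_exists[OF assms]
    unfolding k_def by blast+
  define e where "e = Z0_mult (shift k c) (shift k d)"
  have surj: "decadic (shift k c) * decadic (shift k d) \<in> decadic ` Z0"
    using bij_betw_decadic by (simp add: bij_betw_def)
  have e: "e \<in> Z0" "decadic e = decadic (shift k c) * decadic (shift k d)"
    unfolding e_def Z0_mult_def by (rule inv_into_into[OF surj], rule f_inv_into_f[OF surj])
  have T: "T0_mult c d = shift (- 2 * k) e"
    by (simp add: T0_mult_def e_def k_def Let_def)
  show "T0_mult c d \<in> T0"
    unfolding T using e Z0_subset_T0 by (auto intro: shift_T0)
  have "val e = (10 powi k * val c) * (10 powi k * val d)"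
    using e k by (simp add: val_Z0 flip: val_shift)
  moreover have "(10::real) powi (- 2 * k) * (10 powi k * 10 powi k) = 1"
    by (simp flip: power_int_add)
  ultimately show "val (T0_mult c d) = val c * val d"
    unfolding T val_shift by (simp add: mult_ac)
qed

lemma sgn_val:
  assumes "d \<in> T0"
  shows "sgn (val d) = of_int (dsign d)"
proof (cases "dsign d = 0")
  case False
  then obtain i where "digit d i \<noteq> 0" using dsign_eq_0_iff by blast
  then have "(\<Sum>i | digit d i \<noteq> 0. real_of_int (digit d i) * 10 powi i) > 0"
    using assms digit_range(1)[of d]
    by (intro sum_pos) (auto simp: T0_def order_less_le)
  moreover have "dsign d \<in> {1, -1}" using False decimal_cases[of d] by auto
  ultimately show ?thesis by (auto simp: val_def sgn_mult)
qed (simp add: val_def)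

text \<open>A common shift moves both decimals into \<open>Z0\<close>, where \<open>decadic\<close>
  is injective. Equality of truncations can thus be checked in the reals; the clash of 2 with
  1.999... needs a nonterminating decimal.\<close>

lemma val_inject:
  assumes "c \<in> T0" "d \<in> T0" "val c = val d"
  shows "c = d"
proof -
  obtain k where k: "shift k c \<in> Z0" "shift k d \<in> Z0"
    using shift_Z0_exists assms by blast
  have "of_int (decadic (shift k c)) = (of_int (decadic (shift k d)) :: real)"
    using k assms(3) by (simp add: val_shift flip: val_Z0)
  then have eq: "shift k c = shift k d"
    using k bij_betw_decadic by (auto simp: bij_betw_def inj_on_def)
  show ?thesis
  proof (rule decimal_eqI)
    show "dsign c = dsign d" using arg_cong[OF eq, of dsign] by simp
    show "digit c i = digit d i" for i
      using arg_cong[OF eq, of "\<lambda>x. digit x (i + k)"] by simp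
  qed
qed

section \<open>Approximation of a decimal by its truncations\<close>

text \<open>The absolute value makes the sequence increasing for either sign, and squaring forgets
  the sign anyway.\<close>

definition approx :: "decimal \<Rightarrow> nat \<Rightarrow> real" where
  "approx d n = \<bar>val (trunc d n)\<bar>"

lemma approx_eq_sum:
  assumes "\<And>i. digit d i \<noteq> 0 \<Longrightarrow> i \<le> K"
  shows "approx d n = (\<Sum>i\<in>{- int n..K}. of_int (digit d i) * 10 powi i)"
proof -
  have "{i. digit (trunc d n) i \<noteq> 0} \<subseteq> {- int n..K}"
    using assms by (auto simp: digit_trunc split: if_splits)
  then have "val (trunc d n)
      = of_int (dsign (trunc d n)) * (\<Sum>i\<in>{- int n..K}. of_int (digit (trunc d n) i) * 10 powi i)"
    by (intro val_eq_sum) auto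
  also have "(\<Sum>i\<in>{- int n..K}. real_of_int (digit (trunc d n) i) * 10 powi i)
      = (\<Sum>i\<in>{- int n..K}. of_int (digit d i) * 10 powi i)" (is "_ = ?S")
    by (intro sum.cong) (auto simp: digit_trunc)
  finally have v: "val (trunc d n) = of_int (dsign (trunc d n)) * ?S" .
  have "?S \<ge> 0" by (intro sum_nonneg) (simp add: digit_range)
  \<comment> \<open>A nonzero \<open>d\<close> may have a zero truncation, which has lost its sign;
    then the digit sum vanishes too.\<close>
  moreover have "?S = 0" if "dsign (trunc d n) = 0"
  proof (rule sum.neutral, safe)
    fix i assume "i \<in> {- int n..K}"
    moreover have "digit (trunc d n) i = 0" using that dsign_eq_0_iff by blast
    ultimately show "real_of_int (digit d i) * 10 powi i = 0" by (simp add: digit_trunc)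
  qed
  moreover have "dsign (trunc d n) \<in> {0, 1, -1}" using decimal_cases[of "trunc d n"] by auto
  ultimately show ?thesis unfolding approx_def v by (auto simp: abs_mult)
qed

lemma approx_Suc:
  "approx d (Suc n) = approx d n + of_int (digit d (- int (Suc n))) * 10 powi (- int (Suc n))"
proof -
  obtain K where K: "\<And>i. digit d i \<noteq> 0 \<Longrightarrow> i \<le> int K" using digits_bounded_above by blast
  have "{- int (Suc n)..int K} = insert (- int (Suc n)) {- int n..int K}" by auto
  then show ?thesis by (simp add: approx_eq_sum[OF K])
qed

lemma approx_nonneg: "approx d n \<ge> 0"
  by (simp add: approx_def)

lemma approx_mono: "m \<le> n \<Longrightarrow> approx d m \<le> approx d n"
  by (rule lift_Suc_mono_le[of "approx d"]) (simp_all add: approx_Suc digit_range)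

text \<open>A new digit adds at most 9 units of its place, so the truncation plus one unit in its
  last place can only decrease. This bounds all later truncations at once.\<close>

lemma approx_upper: "m \<le> n \<Longrightarrow> approx d n + 10 powi (- int n) \<le> approx d m + 10 powi (- int m)"
proof (rule lift_Suc_antimono_le[of "\<lambda>n. approx d n + 10 powi (- int n)"])
  fix n
  have "real_of_int (digit d (- int (Suc n))) * 10 powi (- int (Suc n)) \<le> 9 * 10 powi (- int (Suc n))"
    using digit_range(2)[of d "- int (Suc n)"] by (intro mult_right_mono) auto
  moreover have "(10::real) powi (- int n) = 10 * 10 powi (- int (Suc n))"
    using power_int_add[of "10::real" 1 "- int (Suc n)"] by simp
  ultimately show "approx d (Suc n) + 10 powi (- int (Suc n)) \<le> approx d n + 10 powi (- int n)"
    unfolding approx_Suc by simp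
qed

lemma approx_Rats: "approx d n \<in> \<rat>"
  unfolding approx_def val_def
  by (intro Rats_abs_iff[THEN iffD2] Rats_mult Rats_sum) (auto simp: power_int_def)

lemma approx_Ints: "approx d n * 10 ^ n \<in> \<int>"
proof -
  obtain K where K: "\<And>i. digit d i \<noteq> 0 \<Longrightarrow> i \<le> int K" using digits_bounded_above by blast
  have "real_of_int (digit d i) * 10 powi i * 10 ^ n \<in> \<int>" if "i \<ge> - int n" for i
  proof -
    have "(10::real) powi i * 10 ^ n = 10 powi (i + int n)" by (simp add: power_int_add)
    also have "\<dots> = 10 ^ nat (i + int n)" using that by (simp add: power_int_def)
    finally show ?thesis by (simp add: mult.assoc)
  qed
  then show ?thesis by (auto simp: approx_eq_sum[OF K] sum_distrib_right intro!: Ints_sum)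
qed

lemma trunc_eq_self:
  assumes "\<And>i. i < - int n \<Longrightarrow> digit d i = 0"
  shows "trunc d n = d"
proof (rule decimal_eqI)
  show "digit (trunc d n) i = digit d i" for i using assms by (auto simp: digit_trunc)
  show "dsign (trunc d n) = dsign d"
    using assms dsign_eq_0_iff[of d] by (auto simp: dsign_trunc) (metis not_less)
qed

text \<open>Translates truncation into real arithmetic. A terminating decimal has no infinite tail
  of nines, so the digits cut off amount to strictly less than one unit of place
  \<open>- int k\<close>.\<close>

lemma floor_val:
  assumes "d \<in> T0"
  shows "of_int \<lfloor>\<bar>val d\<bar> * 10 ^ k\<rfloor> = approx d k * 10 ^ k"
proof -
  obtain n0 where n0: "\<And>i. i < - int n0 \<Longrightarrow> digit d i = 0"
    using T0_digits_bounded_below[OF assms] by blast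
  \<comment> \<open>Large enough that truncating at \<open>n\<close> changes nothing, and at least
    \<open>k\<close>, so that monotonicity and \<open>approx_upper\<close> compare places
    \<open>k\<close> and \<open>n\<close>.\<close>
  define n where "n = max n0 k"
  have "trunc d n = d" by (rule trunc_eq_self) (auto simp: n_def intro: n0)
  then have v: "\<bar>val d\<bar> = approx d n" by (simp add: approx_def)
  have "approx d k \<le> approx d n" by (rule approx_mono) (simp add: n_def)
  then have lower: "approx d k * 10 ^ k \<le> approx d n * 10 ^ k" by simp
  have "approx d n + 10 powi (- int n) \<le> approx d k + 10 powi (- int k)"
    by (rule approx_upper) (simp add: n_def)
  moreover have "(10::real) powi (- int n) > 0" by simp
  ultimately have "approx d n < approx d k + 10 powi (- int k)" by linarith
  then have "approx d n * 10 ^ k < (approx d k + 10 powi (- int k)) * 10 ^ k" by simp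
  also have "\<dots> = approx d k * 10 ^ k + 1" by (simp add: algebra_simps power_int_minus)
  finally have upper: "approx d n * 10 ^ k < approx d k * 10 ^ k + 1" .
  obtain z where z: "approx d k * 10 ^ k = of_int z" using approx_Ints by (metis Ints_cases)
  have "\<lfloor>approx d n * 10 ^ k\<rfloor> = z" using lower upper z by (intro floor_unique) auto
  then show ?thesis by (simp add: v z)
qed

section \<open>Existence of formal limits\<close>

lemma trunc_eqI:
  assumes "dsign c = dsign d" "\<And>i. i \<ge> - int k \<Longrightarrow> digit c i = digit d i"
  shows "trunc c k = trunc d k"
  using assms by (intro decimal_eqI) (auto simp: digit_trunc dsign_trunc)

lemma digit_zero [simp]: "digit 0 i = 0" and dsign_zero [simp]: "dsign 0 = 0"
  by (transfer, simp)+

text \<open>The stabilised truncations \<open>T k\<close> agree wherever their index ranges overlap,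
  so they glue to one digit string; any nonzero \<open>T k0\<close> supplies the sign and the
  leading digit.\<close>

lemma is_flim_exists:
  assumes T0: "\<And>n. f n \<in> T0"
    and ev: "\<And>k. \<exists>N. \<forall>n\<ge>N. trunc (f n) k = trunc (f N) k"
  shows "\<exists>c. is_flim f c"
proof -
  obtain N where N: "\<And>k n. n \<ge> N k \<Longrightarrow> trunc (f n) k = trunc (f (N k)) k"
    using ev by metis
  define T where "T k = trunc (f (N k)) k" for k
  have T: "trunc (f n) k = T k" if "n \<ge> N k" for n k unfolding T_def by (rule N[OF that])
  show ?thesis
  \<comment> \<open>Here the members of the sequence may still be nonzero, even with changing signs;
    the alternative \<open>c = 0\<close> in \<open>is_flim\<close> admits the limit 0.\<close>
  proof (cases "\<forall>k. T k = 0")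
    case True
    have "trunc 0 k = 0" for k by (rule decimal_eqI) (auto simp: digit_trunc dsign_trunc)
    \<comment> \<open>The successor secures the bound of at least 1 that \<open>is_flim\<close> asks
      for.\<close>
    then have "\<forall>n>Suc (N k). trunc (f n) k = trunc 0 k" for k
      using T[of k] True by simp
    then have "is_flim f 0"
      unfolding is_flim_def using T0 by (metis le_add1 plus_1_eq_Suc)
    then show ?thesis by blast
  next
    case False
    then obtain k0 where k0: "T k0 \<noteq> 0" by blast
    define s where "s = dsign (T k0)"
    have dT: "digit (T k) i = digit (T k') i" if "i \<ge> - int k" "i \<ge> - int k'" for i k k'
      using that T[of k "max (N k) (N k')"] T[of k' "max (N k) (N k')"]
      by (metis digit_trunc max.cobounded1 max.cobounded2)
    have "s \<noteq> 0" using k0 by (metis decimal_eqI digit_zero dsign_eq_0_iff dsign_zero s_def)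
    then obtain l where s: "s \<in> {1, -1}" and l: "digit (T k0) l \<noteq> 0" "\<forall>i>l. digit (T k0) i = 0"
      using decimal_cases[of "T k0"] by (auto simp: s_def)
    have lk: "l \<ge> - int k0" using l(1) by (auto simp: T_def digit_trunc split: if_splits)
    \<comment> \<open>\<open>nat (- i)\<close> is the shortest truncation that still contains index
      \<open>i\<close>.\<close>
    define a where "a i = digit (T (nat (- i))) i" for i
    have a: "a i = digit (T k) i" if "i \<ge> - int k" for i k
      unfolding a_def using that by (intro dT) auto
    have "a l \<noteq> 0" "\<forall>i>l. a i = 0" using l lk a[of k0] by auto
    moreover have "\<forall>i. a i \<in> {0..9}" by (simp add: a_def digit_range)
    ultimately have mem: "(s, a) \<in> decimal_reps"
      unfolding decimal_reps_def using s by blast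
    define c where "c = abs_decimal (s, a)"
    have c: "dsign c = s" "digit c = a"
      using abs_decimal_inverse[OF mem] by (simp_all add: c_def dsign.rep_eq digit.rep_eq)
    have sgn: "dsign (f n) = s" if "n \<ge> N k0" for n
    proof -
      have "dsign (trunc (f n) k0) = s" using T[OF that] by (simp add: s_def)
      with \<open>s \<noteq> 0\<close> show ?thesis by (simp add: dsign_trunc split: if_splits)
    qed
    \<comment> \<open>The first bound on \<open>n\<close> fixes the sign, the second the digits down
      to place \<open>- int k\<close>.\<close>
    have "trunc (f n) k = trunc c k" if "n \<ge> N k0" "n \<ge> N k" for n k
    proof (rule trunc_eqI)
      show "dsign (f n) = dsign c" using sgn that c by simp
      fix i assume i: "i \<ge> - int k"
      then have "digit (f n) i = digit (trunc (f n) k) i" by (simp add: digit_trunc)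
      then show "digit (f n) i = digit c i" using that i T a[of k i] c by simp
    qed
    then have "\<forall>n>Suc (max (N k0) (N k)). dsign c = dsign (f n) \<and> trunc (f n) k = trunc c k" for k
      using sgn c by simp
    then have "is_flim f c"
      unfolding is_flim_def using T0 by (metis le_add1 plus_1_eq_Suc)
    then show ?thesis by blast
  qed
qed

section \<open>Squares as formal limits\<close>

lemma bounded_mono_int_eventually_const:
  fixes u :: "nat \<Rightarrow> int"
  assumes "mono u" "\<And>n. u n \<le> B"
  shows "\<exists>N. \<forall>n\<ge>N. u n = u N"
proof -
  have "range u \<subseteq> {u 0..B}" using assms by (auto dest: monoD)
  then have fin: "finite (range u)" by (rule finite_subset) simp
  then have "Max (range u) \<in> range u" by (intro Max_in) auto
  then obtain N where "Max (range u) = u N" by blast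
  then have "u n \<le> u N" for n using Max_ge[OF fin, of "u n"] by auto
  then show ?thesis using assms(1) by (metis antisym monoD)
qed

definition sq_seq :: "decimal \<Rightarrow> nat \<Rightarrow> decimal" where
  "sq_seq x n = T0_mult (trunc x n) (trunc x n)"

lemma sq_seq_T0: "sq_seq x n \<in> T0"
  by (simp add: sq_seq_def T0_mult_val trunc_T0)

lemma val_sq_seq: "val (sq_seq x n) = (approx x n)\<^sup>2"
  by (simp add: sq_seq_def T0_mult_val trunc_T0 approx_def power2_eq_square)

lemma val_trunc_nonneg:
  assumes "d \<in> T0" "val d \<ge> 0"
  shows "val (trunc d k) = approx d k"
proof -
  have "sgn (val d) \<ge> 0" using assms(2) by simp
  then have "sgn (val (trunc d k)) \<ge> 0" by (simp add: sgn_val assms(1) trunc_T0 dsign_trunc)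
  then have "val (trunc d k) \<ge> 0" by simp
  then show ?thesis by (simp add: approx_def)
qed

text \<open>For fixed \<open>k\<close> the integers \<open>u n\<close> increase and are bounded,
  hence become constant. By \<open>floor_val\<close> they determine the value of the truncation at
  \<open>k\<close>, and by \<open>val_inject\<close> the truncation itself.\<close>

lemma is_flim_square: "is_flim (sq_seq x) (x * x)"
proof -
  have "\<exists>N. \<forall>n\<ge>N. trunc (sq_seq x n) k = trunc (sq_seq x N) k" for k
  proof -
    define u where "u n = \<lfloor>\<bar>val (sq_seq x n)\<bar> * 10 ^ k\<rfloor>" for n
    have "mono u"
      unfolding u_def val_sq_seq
      by (intro monoI floor_mono mult_right_mono) (auto intro!: power_mono approx_mono approx_nonneg)
    \<comment> \<open>The fractional digits of \<open>x\<close> together contribute at most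
      1.\<close>
    moreover have "u n \<le> \<lfloor>(approx x 0 + 1)\<^sup>2 * 10 ^ k\<rfloor>" for n
    proof -
      have "approx x n + 10 powi (- int n) \<le> approx x 0 + 1"
        using approx_upper[of 0 n x] by simp
      moreover have "(10::real) powi (- int n) > 0" by simp
      ultimately have "approx x n \<le> approx x 0 + 1" by linarith
      then show ?thesis unfolding u_def val_sq_seq
        by (intro floor_mono mult_right_mono) (auto intro!: power_mono approx_nonneg)
    qed
    ultimately obtain N where N: "\<And>n. n \<ge> N \<Longrightarrow> u n = u N"
      using bounded_mono_int_eventually_const by blast
    have v: "val (trunc (sq_seq x n) k) * 10 ^ k = of_int (u n)" for n
      unfolding u_def floor_val[OF sq_seq_T0]
      by (simp add: val_trunc_nonneg sq_seq_T0 val_sq_seq)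
    have "trunc (sq_seq x n) k = trunc (sq_seq x N) k" if "n \<ge> N" for n
    proof (rule val_inject[OF trunc_T0 trunc_T0])
      show "val (trunc (sq_seq x n) k) = val (trunc (sq_seq x N) k)"
        using v[of n] v[of N] N[OF that]
        by (metis mult_right_cancel power_not_zero zero_neq_numeral)
    qed
    then show ?thesis by blast
  qed
  then obtain c where c: "is_flim (sq_seq x) c"
    using is_flim_exists[of "sq_seq x"] sq_seq_T0 by blast
  have "x * x = flim (sq_seq x)" by (simp add: times_decimal_def sq_seq_def[abs_def])
  with c show ?thesis by (simp add: flim_eqI)
qed

text \<open>All that the final argument uses about the product: once truncations at \<open>k\<close>
  agree, \<open>floor_val\<close> traps the real square in a half-open interval of length
  \<open>1 / 10 ^ k\<close>.\<close>

lemma square_approx: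
  assumes "k \<ge> 1"
  shows "\<forall>\<^sub>F n in sequentially.
    approx (x * x) k \<le> (approx x n)\<^sup>2 \<and> (approx x n)\<^sup>2 < approx (x * x) k + 1 / 10 ^ k"
proof -
  obtain N where N: "\<And>n. n > N \<Longrightarrow> trunc (sq_seq x n) k = trunc (x * x) k"
    using is_flim_square[of x] assms unfolding is_flim_def by blast
  have "approx (x * x) k \<le> (approx x n)\<^sup>2 \<and> (approx x n)\<^sup>2 < approx (x * x) k + 1 / 10 ^ k"
    if n: "n > N" for n
  proof -
    have "of_int \<lfloor>(approx x n)\<^sup>2 * 10 ^ k\<rfloor> = approx (x * x) k * 10 ^ k"
      using floor_val[OF sq_seq_T0, of x n k] N[OF n] by (simp add: val_sq_seq approx_def)
    then have "approx (x * x) k * 10 ^ k \<le> (approx x n)\<^sup>2 * 10 ^ k"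
      "(approx x n)\<^sup>2 * 10 ^ k < approx (x * x) k * 10 ^ k + 1" by linarith+
    then show ?thesis by (simp add: field_simps)
  qed
  then show ?thesis unfolding eventually_sequentially by (metis Suc_le_eq)
qed

section \<open>Irrationality of the square root of 2, and the two right-hand sides\<close>

lemma square_Rats_neq_2:
  fixes r :: real
  assumes "r \<in> \<rat>"
  shows "r\<^sup>2 \<noteq> 2"
proof
  assume r2: "r\<^sup>2 = 2"
  obtain m n :: nat where mn: "n \<noteq> 0" "\<bar>r\<bar> = real m / real n" "coprime m n"
    using Rats_abs_nat_div_natE[OF assms] by metis
  have "(real m)\<^sup>2 = 2 * (real n)\<^sup>2"
    using mn r2 by (metis (no_types) nonzero_eq_divide_eq of_nat_eq_0_iff power2_abs power_divide power_not_zero)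
  then have eq: "m\<^sup>2 = 2 * n\<^sup>2"
    by (metis of_nat_eq_iff of_nat_mult of_nat_numeral of_nat_power)
  then have "even m" by (metis dvd_triv_left even_power)
  then obtain k where "m = 2 * k" by blast
  with eq have "n\<^sup>2 = 2 * k\<^sup>2" by (simp add: power2_eq_square)
  then have "even n" by (metis dvd_triv_left even_power)
  with \<open>even m\<close> mn(3) show False by (metis coprime_common_divisor odd_one)
qed

lemma approx_dec_two: "approx dec_two k = 2"
proof (induction k)
  case 0
  have "i \<le> 0" if "digit dec_two i \<noteq> 0" for i using that by transfer (auto split: if_splits)
  moreover have "digit dec_two 0 = 2" by transfer simp
  ultimately show ?case by (simp add: approx_eq_sum[of _ 0])
next
  case (Suc k)
  have "digit dec_two (- int (Suc k)) = 0" by transfer simp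
  with Suc show ?case by (simp add: approx_Suc)
qed

text \<open>Appending a nine removes nine tenths of the gap \<open>1 / 10 ^ k\<close> to 2.\<close>

lemma approx_dec_one_nines: "approx dec_one_nines k = 2 - 1 / 10 ^ k"
proof (induction k)
  case 0
  have "i \<le> 0" if "digit dec_one_nines i \<noteq> 0" for i using that by transfer (auto split: if_splits)
  moreover have "digit dec_one_nines 0 = 1" by transfer simp
  ultimately show ?case by (simp add: approx_eq_sum[of _ 0])
next
  case (Suc k)
  have "digit dec_one_nines (- int (Suc k)) = 9" by transfer simp
  moreover have "(10::real) powi (- int (Suc k)) = 1 / 10 ^ Suc k"
    unfolding power_int_minus power_int_of_nat by (simp add: inverse_eq_divide)
  ultimately show ?case unfolding approx_Suc Suc by (simp add: field_simps)
qed

section \<open>Rationality of ultimately periodic decimals\<close>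

text \<open>Scaling by \<open>q\<close> moves the digits one period to the right, so both terms of
  \<open>W\<close> eventually grow by the same amount. The constant rational value of
  \<open>W\<close> then equals \<open>L * (1 - q)\<close>.\<close>

lemma ult_periodic_limit_Rats:
  assumes "x \<in> ult_periodic" "approx x \<longlonglongrightarrow> L"
  shows "L \<in> \<rat>"
proof -
  obtain m p where p: "p \<ge> 1" and per: "\<And>i. i < m \<Longrightarrow> digit x i = digit x (i - int p)"
    using assms(1) unfolding ult_periodic_def by auto
  define q :: real where "q = 10 powi (- int p)"
  define W where "W n = approx x (n + p) - q * approx x n" for n
  \<comment> \<open>From \<open>M\<close> on, the next digit index \<open>- int (Suc n)\<close> lies
    below \<open>m\<close>, inside the periodic range.\<close>
  define M where "M = nat (- m)"
  have W_Suc: "W (Suc n) = W n" if "n \<ge> M" for n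
  proof -
    have "- int (Suc n) < m" using that by (simp add: M_def)
    from per[OF this] have "digit x (- int (Suc (n + p))) = digit x (- int (Suc n))"
      by (simp add: algebra_simps)
    moreover have "(10::real) powi (- int (Suc (n + p))) = q * 10 powi (- int (Suc n))"
      unfolding q_def by (simp add: algebra_simps flip: power_int_add)
    ultimately have "approx x (Suc (n + p)) - approx x (n + p)
        = q * (approx x (Suc n) - approx x n)"
      unfolding approx_Suc by simp
    then show ?thesis by (simp add: W_def algebra_simps)
  qed
  have W: "W n = W M" if "n \<ge> M" for n
    using that by (induction rule: dec_induct) (simp_all add: W_Suc)
  have "W \<longlonglongrightarrow> L - q * L"
    unfolding W_def[abs_def]
    by (intro tendsto_diff tendsto_mult tendsto_const assms(2) LIMSEQ_ignore_initial_segment)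
  moreover have "W \<longlonglongrightarrow> W M"
    by (rule tendsto_eventually, rule eventually_sequentiallyI, rule W)
  ultimately have L: "L - q * L = W M" by (rule LIMSEQ_unique)
  have "q < 1" using p one_less_power[of "10::real" p] by (simp add: q_def power_int_minus inverse_less_1_iff)
  then have "1 - q \<noteq> 0" by simp
  moreover have "L * (1 - q) = W M" unfolding L[symmetric] by (simp add: algebra_simps)
  ultimately have "L = W M / (1 - q)" by (rule eq_divide_imp)
  moreover have "q \<in> \<rat>" by (simp add: q_def power_int_minus)
  ultimately show ?thesis by (auto simp: W_def approx_Rats)
qed

section \<open>The two equations\<close>

theorem proposition3p3:
  shows "(\<nexists>x :: decimal. x * x = dec_two) \<and>
         (\<nexists>x. x \<in> ult_periodic \<and> x * x = dec_one_nines)"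
proof (intro conjI notI; elim exE conjE)
  fix x :: decimal
  assume x: "x * x = dec_two"
  have ev: "\<exists>N. \<forall>n\<ge>N. 2 \<le> (approx x n)\<^sup>2 \<and> (approx x n)\<^sup>2 < 2 + 1 / 10 ^ k" if "k \<ge> 1" for k
    using square_approx[OF that, of x] by (simp add: x approx_dec_two eventually_sequentially)
  \<comment> \<open>Since every truncation of \<open>dec_two\<close> has value exactly 2, the lower
    bound is already 2 at \<open>k = 1\<close>.\<close>
  obtain N where N: "2 \<le> (approx x N)\<^sup>2" using ev[of 1] by auto
  \<comment> \<open>\<open>N\<close> stays fixed while \<open>k\<close> grows: each upper bound
    holds at some later \<open>n\<close> and passes back to \<open>N\<close> by
    monotonicity.\<close>
  have "(approx x N)\<^sup>2 \<le> 2 + 1 / 10 ^ k" if k: "k \<ge> 1" for k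
  proof -
    obtain n where "n \<ge> N" "(approx x n)\<^sup>2 < 2 + 1 / 10 ^ k" using ev[OF k] by (meson nle_le)
    moreover from this have "(approx x N)\<^sup>2 \<le> (approx x n)\<^sup>2"
      by (intro power_mono approx_mono approx_nonneg)
    ultimately show ?thesis by linarith
  qed
  moreover have "(\<lambda>k. 2 + 1 / 10 ^ k :: real) \<longlonglongrightarrow> 2"
    using tendsto_add[OF tendsto_const[of 2] LIMSEQ_inverse_realpow_zero[of "10::real"]]
    by (simp add: inverse_eq_divide)
  ultimately have "(approx x N)\<^sup>2 \<le> 2" by (intro LIMSEQ_le_const) auto
  with N show False using square_Rats_neq_2[OF approx_Rats, of x N] by simp
next
  fix x
  assume per: "x \<in> ult_periodic" and x: "x * x = dec_one_nines"
  have "(\<lambda>n. (approx x n)\<^sup>2) \<longlonglongrightarrow> 2"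
  proof (rule LIMSEQ_I)
    fix e :: real assume "e > 0"
    then obtain k where "(1 / 10) ^ k < e" using real_arch_pow_inv[of e "1 / 10"] by auto
    \<comment> \<open>\<open>Suc k\<close> replaces \<open>k\<close> because
      \<open>square_approx\<close> requires a positive number of places.\<close>
    moreover have "(1 / 10 :: real) ^ Suc k \<le> (1 / 10) ^ k" by simp
    ultimately have k: "1 / 10 ^ Suc k < e" by (simp add: power_one_over)
    obtain N where N: "\<And>n. n \<ge> N \<Longrightarrow>
        2 - 1 / 10 ^ Suc k \<le> (approx x n)\<^sup>2 \<and> (approx x n)\<^sup>2 < 2 - 1 / 10 ^ Suc k + 1 / 10 ^ Suc k"
      using square_approx[of "Suc k" x] unfolding x approx_dec_one_nines eventually_sequentially
      by auto
    have "norm ((approx x n)\<^sup>2 - 2) < e" if "n \<ge> N" for n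
      using N[OF that] k by (simp add: abs_if del: power_Suc)
    then show "\<exists>N. \<forall>n\<ge>N. norm ((approx x n)\<^sup>2 - 2) < e" by blast
  qed
  from tendsto_real_sqrt[OF this] have "approx x \<longlonglongrightarrow> sqrt 2"
    by (simp add: approx_nonneg)
  then have "sqrt 2 \<in> \<rat>" using per by (rule ult_periodic_limit_Rats[rotated])
  then show False using square_Rats_neq_2 by force
qed

end
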